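(* Let $Q\in\mathbb{S}^n$, $c\in\mathbb{R}^n$, $A\in\mathbb{R}^{m\times n}$ of full row rank, $b\in\mathbb{R}^m$, $B\in\mathbb{R}^{l\times n}$, $d\in\mathbb{R}^l$, and let $k$ be an integer with $0<k<n$. Assume that the feasible region of the problem (QP) below is nonempty and that its objective is bounded from below over its feasible set. Then the optimal values of the problems (QP), (SDP), (SDP-RLT), (RED) and (SC) defined in the context satisfy $$\mathrm{val}(\mathrm{SDP})\ \le\ \mathrm{val}(\mathrm{SDP\text{-}RLT})\ =\ \mathrm{val}(\mathrm{RED})\ =\ \mathrm{val}(\mathrm{SC})\ \le\ \mathrm{val}(\mathrm{QP}).$$
   Context: $\mathbb{S}^n$ is the space of real symmetric $n\times n$ matrices, $\mathbb{S}^n_+$ its cone of positive semidefinite matrices, $\langle U,V\rangle=\mathrm{Tr}(UV^\top)$. $\|x\|_0$ is the number of nonzero entries of $x$; $e$ is the all-ones vector; $\operatorname{diag}(M)$ is the vector of diagonal entries of a matrix $M$; $\operatorname{Diag}(M)$ is the diagonal matrix with the same diagonal as $M$. Matrix inequalities $\ge 0$ are entrywise. $\mathrm{val}(\cdot)$ denotes optimal value (infimum, possibly $-\infty$). For $Y=\begin{bmatrix}Y_{11}&Y_{12} \\ Y_{21}&Y_{22}\end{bmatrix}\in\mathbb{S}^{n+1}$ ($Y_{11}\in\mathbb{R}$, $Y_{22}\in\mathbb{S}^n$) define $$\mathcal{A}(Y)=\begin{bmatrix}-b&A\end{bmatrix}Y\begin{bmatrix}-b^\top \\ A^\top\end{bmatrix},\qquad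 \mathcal{B}(Y)=\begin{bmatrix}1&0 \\ -d&B\end{bmatrix}Y\begin{bmatrix}1&0 \\ -d&B\end{bmatrix}^\top,$$ $$\mathcal{K}=\left\{Y\in\mathbb{S}^{n+1}:\begin{bmatrix}kY_{11}&Y_{12} \\ Y_{21}&\operatorname{Diag}(Y_{22})\end{bmatrix}\succeq0\right\},\qquad \overline{Q}=\begin{bmatrix}0&c^\top \\ c&Q\end{bmatrix},\qquad \mathcal{Z}=\{z\in[0,1]^n:\ e^\top z\le k\}.$$ (QP): $\min_{x\in\mathbb{R}^n}\{x^\top Qx+2c^\top x\ :\ Ax=b,\ Bx\ge d,\ \|x\|_0\le k\}$. (SDP): minimize $\langle Q,X_{xx}\rangle+2c^\top x$ over $x,z\in\mathbb{R}^n$, $X_{xx},X_{zz}\in\mathbb{S}^n$, $X_{xz}\in\mathbb{R}^{n\times n}$ subject to $Ax=b$, $Bx\ge d$, $x=\operatorname{diag}(X_{xz})$, $z=\operatorname{diag}(X_{zz})$, $z\in\mathcal{Z}$ and $$\begin{bmatrix}1&x^\top&z^\top \\ x&X_{xx}&X_{xz} \\ z&X_{xz}^\top&X_{zz}\end{bmatrix}\succeq0.$$ (SDP-RLT): the same problem as (SDP) but with the constraints $Ax=b$, $Bx\ge d$ replaced by $\mathcal{A}(Y)=0$, $\mathcal{B}(Y)\ge0$, where $Y=\begin{bmatrix}1&x^\top \\ x&X_{xx}\end{bmatrix}$. (RED): minimize $\langle\overline{Q},Y\rangle$ over $Y=\begin{bmatrix}Y_{11}&x^\top \\ x&X\end{bmatrix}\in\mathbb{S}^{n+1}$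 and $z\in\mathbb{R}^n$ subject to $\mathcal{A}(Y)=0$, $\mathcal{B}(Y)\ge0$, $Y_{11}=1$, $Y\succeq0$, $z\in\mathcal{Z}$ and $\begin{bmatrix}z_i&x_i \\ x_i&X_{ii}\end{bmatrix}\succeq0$ for all $i\in\{1,\dots,n\}$. (SC): $\min_{Y\in\mathbb{S}^{n+1}}\{\langle\overline{Q},Y\rangle:\ \mathcal{A}(Y)=0,\ \mathcal{B}(Y)\ge0,\ Y_{11}=1,\ Y\in\mathcal{K}\cap\mathbb{S}^{n+1}_+\}$. *)

theory Defs
  imports "Jordan_Normal_Form.DL_Rank" "HOL-Library.Extended_Real"
begin

text \<open>
  Vectors and matrices are those of Jordan_Normal_Form, so all dimensions are natural numbers
  (indices start at 0) and the orders on vectors and matrices are entrywise.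
\<close>

section \<open>Matrices\<close>

definition symmetric_mats :: "nat \<Rightarrow> real mat set" where
  "symmetric_mats n = {M \<in> carrier_mat n n. transpose_mat M = M}"

definition psd_cone :: "nat \<Rightarrow> real mat set" where
  "psd_cone n = {M \<in> symmetric_mats n. \<forall>v \<in> carrier_vec n. 0 \<le> v \<bullet> (M *\<^sub>v v)}"

definition trace_mat :: "real mat \<Rightarrow> real" where
  "trace_mat M = sum_list (diag_mat M)"

definition mat_inner :: "real mat \<Rightarrow> real mat \<Rightarrow> real" where
  "mat_inner U V = trace_mat (U * transpose_mat V)"

definition diag_part :: "real mat \<Rightarrow> real mat" where
  "diag_part M = mat_diag (dim_row M) (\<lambda>i. M $$ (i, i))"

definition diag_vec :: "real mat \<Rightarrow> real vec" where
  "diag_vec M = vec_of_list (diag_mat M)"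

definition mat_of_col :: "real vec \<Rightarrow> real mat" where
  "mat_of_col v = mat_of_cols (dim_vec v) [v]"

text \<open>The block row \<open>[M N]\<close>, as a four-block matrix whose lower blocks have no rows.\<close>

definition append_cols :: "real mat \<Rightarrow> real mat \<Rightarrow> real mat" where
  "append_cols M N = four_block_mat M N (0\<^sub>m 0 (dim_col M)) (0\<^sub>m 0 (dim_col N))"

text \<open>The block matrix with rows \<open>[a x\<^sup>T]\<close> and \<open>[x X]\<close>.\<close>

definition bordered :: "real \<Rightarrow> real vec \<Rightarrow> real mat \<Rightarrow> real mat" where
  "bordered a x X = four_block_mat (a \<cdot>\<^sub>m 1\<^sub>m 1) (mat_of_row x) (mat_of_col x) X"

definition ones_vec :: "nat \<Rightarrow> real vec" where
  "ones_vec n = vec n (\<lambda>_. 1)"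

definition l0_norm :: "real vec \<Rightarrow> nat" where
  "l0_norm x = card {i. i < dim_vec x \<and> x $ i \<noteq> 0}"

section \<open>Ingredients of the problems\<close>

definition A_op :: "real mat \<Rightarrow> real vec \<Rightarrow> real mat \<Rightarrow> real mat" where
  "A_op A b Y =
    (let F = append_cols (mat_of_col (- b)) A in F * Y * transpose_mat F)"

definition B_op :: "nat \<Rightarrow> real mat \<Rightarrow> real vec \<Rightarrow> real mat \<Rightarrow> real mat" where
  "B_op n B d Y =
    (let G = four_block_mat (1\<^sub>m 1) (0\<^sub>m 1 n) (mat_of_col (- d)) B in G * Y * transpose_mat G)"

definition K_cone :: "nat \<Rightarrow> nat \<Rightarrow> real mat set" where
  "K_cone n k = {Y \<in> symmetric_mats (n + 1).
     case split_block Y 1 1 of (Y11, Y12, Y21, Y22) \<Rightarrow>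
       four_block_mat (real k \<cdot>\<^sub>m Y11) Y12 Y21 (diag_part Y22) \<in> psd_cone (n + 1)}"

definition Z_set :: "nat \<Rightarrow> nat \<Rightarrow> real vec set" where
  "Z_set n k = {z \<in> carrier_vec n.
     0\<^sub>v n \<le> z \<and> z \<le> ones_vec n \<and> ones_vec n \<bullet> z \<le> real k}"

section \<open>The optimization problems\<close>

definition opt_val :: "('a \<Rightarrow> real) \<Rightarrow> 'a set \<Rightarrow> ereal" where
  "opt_val f S = (INF p\<in>S. ereal (f p))"

definition QP_obj :: "real mat \<Rightarrow> real vec \<Rightarrow> real vec \<Rightarrow> real" where
  "QP_obj Q c x = x \<bullet> (Q *\<^sub>v x) + 2 * (c \<bullet> x)"

definition QP_feasible ::
  "nat \<Rightarrow> nat \<Rightarrow> real mat \<Rightarrow> real vec \<Rightarrow> real mat \<Rightarrow> real vec \<Rightarrow> real vec set" where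
  "QP_feasible n k A b B d = {x \<in> carrier_vec n.
     A *\<^sub>v x = b \<and> d \<le> B *\<^sub>v x \<and> l0_norm x \<le> k}"

text \<open>A point of the lifted problems is a tuple \<open>(x, z, Xxx, Xxz, Xzz)\<close>.\<close>

type_synonym lifted = "real vec \<times> real vec \<times> real mat \<times> real mat \<times> real mat"

definition lifted_region :: "nat \<Rightarrow> nat \<Rightarrow> lifted set" where
  "lifted_region n k = {(x, z, Xxx, Xxz, Xzz).
     x \<in> carrier_vec n \<and> z \<in> carrier_vec n \<and>
     Xxx \<in> symmetric_mats n \<and> Xzz \<in> symmetric_mats n \<and> Xxz \<in> carrier_mat n n \<and>
     x = diag_vec Xxz \<and> z = diag_vec Xzz \<and> z \<in> Z_set n k \<and>
     bordered 1 (x @\<^sub>v z) (four_block_mat Xxx Xxz (transpose_mat Xxz) Xzz)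
       \<in> psd_cone (1 + n + n)}"

definition SDP_obj :: "real mat \<Rightarrow> real vec \<Rightarrow> lifted \<Rightarrow> real" where
  "SDP_obj Q c = (\<lambda>(x, z, Xxx, Xxz, Xzz). mat_inner Q Xxx + 2 * (c \<bullet> x))"

definition SDP_feasible ::
  "nat \<Rightarrow> nat \<Rightarrow> real mat \<Rightarrow> real vec \<Rightarrow> real mat \<Rightarrow> real vec \<Rightarrow> lifted set" where
  "SDP_feasible n k A b B d = {(x, z, Xxx, Xxz, Xzz) \<in> lifted_region n k.
     A *\<^sub>v x = b \<and> d \<le> B *\<^sub>v x}"

definition SDP_RLT_feasible ::
  "nat \<Rightarrow> nat \<Rightarrow> nat \<Rightarrow> nat \<Rightarrow> real mat \<Rightarrow> real vec \<Rightarrow> real mat \<Rightarrow> real vec \<Rightarrow> lifted set" where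
  "SDP_RLT_feasible n m l k A b B d = {(x, z, Xxx, Xxz, Xzz) \<in> lifted_region n k.
     A_op A b (bordered 1 x Xxx) = 0\<^sub>m m m \<and>
     0\<^sub>m (1 + l) (1 + l) \<le> B_op n B d (bordered 1 x Xxx)}"

definition Q_bar :: "real mat \<Rightarrow> real vec \<Rightarrow> real mat" where
  "Q_bar Q c = bordered 0 c Q"

definition RED_obj :: "real mat \<Rightarrow> real vec \<Rightarrow> real mat \<times> real vec \<Rightarrow> real" where
  "RED_obj Q c = (\<lambda>(Y, z). mat_inner (Q_bar Q c) Y)"

definition RED_feasible ::
  "nat \<Rightarrow> nat \<Rightarrow> nat \<Rightarrow> nat \<Rightarrow> real mat \<Rightarrow> real vec \<Rightarrow> real mat \<Rightarrow> real vec
     \<Rightarrow> (real mat \<times> real vec) set" where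
  "RED_feasible n m l k A b B d = {(Y, z). \<exists>Y11 x X.
     Y = bordered Y11 x X \<and> x \<in> carrier_vec n \<and> X \<in> carrier_mat n n \<and>
     Y \<in> symmetric_mats (n + 1) \<and> z \<in> carrier_vec n \<and>
     A_op A b Y = 0\<^sub>m m m \<and> 0\<^sub>m (1 + l) (1 + l) \<le> B_op n B d Y \<and>
     Y11 = 1 \<and> Y \<in> psd_cone (n + 1) \<and> z \<in> Z_set n k \<and>
     (\<forall>i<n. mat_of_rows_list 2 [[z $ i, x $ i], [x $ i, X $$ (i, i)]] \<in> psd_cone 2)}"

definition SC_obj :: "real mat \<Rightarrow> real vec \<Rightarrow> real mat \<Rightarrow> real" where
  "SC_obj Q c Y = mat_inner (Q_bar Q c) Y"

definition SC_feasible ::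
  "nat \<Rightarrow> nat \<Rightarrow> nat \<Rightarrow> nat \<Rightarrow> real mat \<Rightarrow> real vec \<Rightarrow> real mat \<Rightarrow> real vec \<Rightarrow> real mat set" where
  "SC_feasible n m l k A b B d = {Y \<in> symmetric_mats (n + 1).
     A_op A b Y = 0\<^sub>m m m \<and> 0\<^sub>m (1 + l) (1 + l) \<le> B_op n B d Y \<and>
     Y $$ (0, 0) = 1 \<and> Y \<in> K_cone n k \<inter> psd_cone (n + 1)}"

end

theory Submission
  imports Defs
begin

text \<open>
  Only the lifting of a feasible point \<open>(Y, z)\<close> of (RED) to one of (SDP-RLT) is not a direct
  calculation. Regard \<open>Y\<close> as the Gram matrix of \<open>u\<^sub>0, \<dots>, u\<^sub>n\<close>. Vectors \<open>w\<^sub>i\<close> are needed with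
  \<open>\<langle>u\<^sub>0, w\<^sub>i\<rangle> = z\<^sub>i\<close>, \<open>\<langle>u\<^sub>i, w\<^sub>i\<rangle> = x\<^sub>i\<close> and \<open>\<parallel>w\<^sub>i\<parallel>\<^sup>2 = z\<^sub>i\<close>, all their other inner products being
  free. So each \<open>w\<^sub>i\<close> can be chosen on its own, as a combination of \<open>u\<^sub>0\<close>, \<open>u\<^sub>i\<close> and a new
  direction orthogonal to everything else. A point \<open>Y = [1 x\<^sup>T; x X]\<close> of (SC) is completed to
  one of (RED) by \<open>z\<^sub>i = x\<^sub>i\<^sup>2 / X\<^sub>i\<^sub>i\<close>, whose sum is at most \<open>k\<close> by the cone condition. A sparse
  \<open>x\<close> yields the rank-one \<open>Y\<close>, with \<open>z\<close> the indicator of its support.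
\<close>

section \<open>Bordered matrices: bilinear form, symmetry, semidefiniteness\<close>

lemma mult_bordered_vCons:
  assumes "x \<in> carrier_vec n" "X \<in> carrier_mat n n" "u \<in> carrier_vec n"
  shows "bordered a x X *\<^sub>v vCons t u = vCons (a * t + x \<bullet> u) (t \<cdot>\<^sub>v x + X *\<^sub>v u)"
proof -
  \<comment> \<open>Rewriting \<open>vCons\<close> as an append lets the product be computed by
    blocks.\<close>
  have v: "vCons s w = vec 1 (\<lambda>_. s) @\<^sub>v w" for s :: real and w
    by (intro eq_vecI) (auto simp: vec_index_vCons)
  have "bordered a x X *\<^sub>v vCons t u
      = ((a \<cdot>\<^sub>m 1\<^sub>m 1) *\<^sub>v vec 1 (\<lambda>_. t) + mat_of_row x *\<^sub>v u)
          @\<^sub>v (mat_of_col x *\<^sub>v vec 1 (\<lambda>_. t) + X *\<^sub>v u)"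
    unfolding bordered_def v
    by (rule four_block_mat_mult_vec[of _ 1 1 _ n _ n]) (use assms in \<open>auto simp: mat_of_col_def\<close>)
  also have "(a \<cdot>\<^sub>m 1\<^sub>m 1) *\<^sub>v vec 1 (\<lambda>_. t) + mat_of_row x *\<^sub>v u = vec 1 (\<lambda>_. a * t + x \<bullet> u)"
    by (intro eq_vecI) (auto simp: scalar_prod_def)
  also have "mat_of_col x *\<^sub>v vec 1 (\<lambda>_. t) = t \<cdot>\<^sub>v x"
    by (intro eq_vecI) (auto simp: scalar_prod_def mat_of_col_def mat_of_cols_index)
  finally show ?thesis by (simp add: v)
qed

lemma bordered_form:
  assumes "x \<in> carrier_vec n" "X \<in> carrier_mat n n" "u \<in> carrier_vec n" "w \<in> carrier_vec n"
  shows "vCons s w \<bullet> (bordered a x X *\<^sub>v vCons t u)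
       = a * s * t + s * (x \<bullet> u) + t * (x \<bullet> w) + w \<bullet> (X *\<^sub>v u)"
  using assms comm_scalar_prod[of w n x]
  by (simp add: mult_bordered_vCons[of x n] scalar_prod_add_distrib[of w n] algebra_simps)

lemma bordered_carrier:
  assumes "x \<in> carrier_vec n" "X \<in> carrier_mat n n"
  shows "bordered a x X \<in> carrier_mat (Suc n) (Suc n)"
  using assms unfolding bordered_def by (auto simp: mat_of_col_def)

lemma bordered_index:
  assumes "x \<in> carrier_vec n" "X \<in> carrier_mat n n"
  shows "bordered a x X $$ (0, 0) = a"
    and "j < n \<Longrightarrow> bordered a x X $$ (0, Suc j) = x $ j"
    and "i < n \<Longrightarrow> bordered a x X $$ (Suc i, 0) = x $ i"
    and "i < n \<Longrightarrow> j < n \<Longrightarrow> bordered a x X $$ (Suc i, Suc j) = X $$ (i, j)"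
  using assms unfolding bordered_def by (auto simp: mat_of_col_def mat_of_cols_index)

lemma symmetric_mats_index:
  "M \<in> symmetric_mats n \<Longrightarrow> i < n \<Longrightarrow> j < n \<Longrightarrow> M $$ (i, j) = M $$ (j, i)"
  unfolding symmetric_mats_def using index_transpose_mat(1)[of j M i] by auto

lemma symmetric_matsI:
  assumes "M \<in> carrier_mat n n" "\<And>i j. i < n \<Longrightarrow> j < n \<Longrightarrow> M $$ (i, j) = M $$ (j, i)"
  shows "M \<in> symmetric_mats n"
  unfolding symmetric_mats_def using assms by auto

lemma symmetric_mats_carrier: "M \<in> symmetric_mats n \<Longrightarrow> M \<in> carrier_mat n n"
  unfolding symmetric_mats_def by simp

lemma bordered_symmetric_iff:
  assumes x: "x \<in> carrier_vec n" and X: "X \<in> carrier_mat n n"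
  shows "bordered a x X \<in> symmetric_mats (Suc n) \<longleftrightarrow> X \<in> symmetric_mats n"
proof
  assume b: "bordered a x X \<in> symmetric_mats (Suc n)"
  show "X \<in> symmetric_mats n"
  proof (rule symmetric_matsI[OF X])
    fix i j assume "i < n" "j < n"
    then show "X $$ (i, j) = X $$ (j, i)"
      using symmetric_mats_index[OF b, of "Suc i" "Suc j"] by (simp add: bordered_index[OF x X])
  qed
next
  assume s: "X \<in> symmetric_mats n"
  show "bordered a x X \<in> symmetric_mats (Suc n)"
  proof (rule symmetric_matsI[OF bordered_carrier[OF x X]])
    fix i j assume "i < Suc n" "j < Suc n"
    then show "bordered a x X $$ (i, j) = bordered a x X $$ (j, i)"
      by (cases i; cases j) (auto simp: bordered_index[OF x X] intro: symmetric_mats_index[OF s])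
  qed
qed

text \<open>Splitting off the first coordinate of the test vector turns semidefiniteness into a
  scalar inequality in \<open>t\<close> and \<open>u\<close>. All later semidefiniteness arguments
  choose \<open>t\<close> and \<open>u\<close> in it or verify it.\<close>

lemma bordered_psd_iff:
  assumes "x \<in> carrier_vec n" and "X \<in> carrier_mat n n"
  shows "bordered a x X \<in> psd_cone (Suc n) \<longleftrightarrow>
    X \<in> symmetric_mats n \<and>
    (\<forall>t. \<forall>u \<in> carrier_vec n. 0 \<le> a * t\<^sup>2 + 2 * t * (x \<bullet> u) + u \<bullet> (X *\<^sub>v u))"
proof -
  have "(\<forall>v \<in> carrier_vec (Suc n). P v) \<longleftrightarrow> (\<forall>t. \<forall>u \<in> carrier_vec n. P (vCons t u))"
    for P :: "real vec \<Rightarrow> bool"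
  proof safe
    fix v :: "real vec"
    assume "\<forall>t. \<forall>u \<in> carrier_vec n. P (vCons t u)" "v \<in> carrier_vec (Suc n)"
    then show "P v" by (cases v) auto
  qed auto
  moreover have "vCons t u \<bullet> (bordered a x X *\<^sub>v vCons t u)
      = a * t\<^sup>2 + 2 * t * (x \<bullet> u) + u \<bullet> (X *\<^sub>v u)" if "u \<in> carrier_vec n" for t u
    using that by (simp add: bordered_form[of x n] assms power2_eq_square)
  ultimately show ?thesis
    unfolding psd_cone_def by (simp add: bordered_symmetric_iff assms)
qed

text \<open>Points of (SC) are unstructured symmetric matrices; this gives them the block form in
  which (RED) is stated.\<close>

lemma symmetric_mats_bordered:
  assumes Y: "Y \<in> symmetric_mats (Suc n)"
  obtains x X where "Y = bordered (Y $$ (0, 0)) x X" "x \<in> carrier_vec n" "X \<in> symmetric_mats n"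
proof
  let ?x = "vec n (\<lambda>i. Y $$ (0, Suc i))" and ?X = "mat n n (\<lambda>(i, j). Y $$ (Suc i, Suc j))"
  note Yc = symmetric_mats_carrier[OF Y]
  have c: "?x \<in> carrier_vec n" "?X \<in> carrier_mat n n" by auto
  show "?x \<in> carrier_vec n" by (fact c)
  show "?X \<in> symmetric_mats n"
    by (rule symmetric_matsI) (auto intro: symmetric_mats_index[OF Y])
  show "Y = bordered (Y $$ (0, 0)) ?x ?X"
  proof (rule eq_matI)
    fix i j
    assume "i < dim_row (bordered (Y $$ (0, 0)) ?x ?X)" "j < dim_col (bordered (Y $$ (0, 0)) ?x ?X)"
    then have "i < Suc n" "j < Suc n"
      by (simp_all only: carrier_matD[OF bordered_carrier[OF c]])
    then show "Y $$ (i, j) = bordered (Y $$ (0, 0)) ?x ?X $$ (i, j)"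
      by (cases i; cases j) (auto simp: bordered_index[OF c] intro: symmetric_mats_index[OF Y])
  qed (simp_all only: carrier_matD[OF bordered_carrier[OF c]] carrier_matD[OF Yc])
qed

section \<open>The diagonal part, the cone \<open>K_cone\<close> and 2 by 2 matrices\<close>

lemma diag_part_carrier: "X \<in> carrier_mat n n \<Longrightarrow> diag_part X \<in> carrier_mat n n"
  unfolding diag_part_def by (auto simp: mat_diag_def)

lemma diag_part_symmetric: "X \<in> carrier_mat n n \<Longrightarrow> diag_part X \<in> symmetric_mats n"
  by (rule symmetric_matsI[OF diag_part_carrier]) (auto simp: diag_part_def mat_diag_def)

lemma bordered_K_cone_iff:
  assumes x: "x \<in> carrier_vec n" and X: "X \<in> symmetric_mats n"
  shows "bordered a x X \<in> K_cone n k \<longleftrightarrow> bordered (real k * a) x (diag_part X) \<in> psd_cone (Suc n)"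
proof -
  have Xc: "X \<in> carrier_mat n n" by (rule symmetric_mats_carrier[OF X])
  have "split_block (bordered a x X) 1 1 = (a \<cdot>\<^sub>m 1\<^sub>m 1, mat_of_row x, mat_of_col x, X)"
    using x Xc
    unfolding split_block_def bordered_def Let_def prod.inject
    by (intro conjI eq_matI) (auto simp: mat_of_col_def mat_of_cols_index)
  moreover have "real k \<cdot>\<^sub>m (a \<cdot>\<^sub>m 1\<^sub>m 1) = (real k * a) \<cdot>\<^sub>m 1\<^sub>m 1" 
    by (rule eq_matI) auto
  moreover have "bordered a x X \<in> symmetric_mats (Suc n)"
    using bordered_symmetric_iff[OF x Xc] X by simp
  ultimately show ?thesis
    unfolding K_cone_def by (simp add: bordered_def)
qed

text \<open>The diagonal form separates the coordinates. This is what links the single cone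
  constraint of (SC) with the n separate 2 by 2 constraints of (RED).\<close>

lemma diag_part_form:
  assumes "X \<in> carrier_mat n n" "u \<in> carrier_vec n"
  shows "u \<bullet> (diag_part X *\<^sub>v u) = (\<Sum>i<n. X $$ (i, i) * (u $ i)\<^sup>2)"
proof -
  have "(diag_part X *\<^sub>v u) $ i = X $$ (i, i) * u $ i" if "i < n" for i
  proof -
    have "(diag_part X *\<^sub>v u) $ i = (\<Sum>j<n. (if i = j then X $$ (j, j) else 0) * u $ j)"
      using assms that unfolding diag_part_def mat_diag_def
      by (simp add: scalar_prod_def lessThan_atLeast0)
    also have "\<dots> = (\<Sum>j<n. if j = i then X $$ (i, i) * u $ i else 0)"
      by (rule sum.cong) auto
    finally show ?thesis using that by simp
  qed
  then show ?thesis
    using assms diag_part_carrier[OF assms(1)]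
    by (auto simp: scalar_prod_def lessThan_atLeast0 power2_eq_square intro!: sum.cong)
qed

text \<open>Well-chosen test points yield the determinant condition; conversely, completing the
  square yields nonnegativity.\<close>

lemma binary_form_nonneg_iff:
  fixes p q r :: real
  shows "(\<forall>s t. 0 \<le> p * s\<^sup>2 + 2 * s * t * q + r * t\<^sup>2) \<longleftrightarrow> 0 \<le> p \<and> 0 \<le> r \<and> q\<^sup>2 \<le> p * r"
proof safe
  assume f: "\<forall>s t. 0 \<le> p * s\<^sup>2 + 2 * s * t * q + r * t\<^sup>2"
  show p: "0 \<le> p" and r: "0 \<le> r" using f[rule_format, of 1 0] f[rule_format, of 0 1] by auto
  show "q\<^sup>2 \<le> p * r"
  proof (cases "r = 0")
    case True
    \<comment> \<open>Without the \<open>t\<close>-square, the point \<open>s = q\<close>,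
      \<open>t = - (p + 1)\<close> gives the value \<open>- (p + 2) * q\<^sup>2\<close>, which
      forces \<open>q = 0\<close>.\<close>
    have "0 \<le> p * q\<^sup>2 - 2 * q\<^sup>2 * (p + 1)"
      using f[rule_format, of q "- (p + 1)"] True by (simp add: power2_eq_square algebra_simps)
    then have "(p + 2) * q\<^sup>2 \<le> 0" by (simp add: algebra_simps)
    then show ?thesis using p True by (simp add: mult_le_0_iff)
  next
    case False
    \<comment> \<open>At \<open>s = r\<close>, \<open>t = - q\<close> the form equals
      \<open>r\<close> times the determinant.\<close>
    have "0 \<le> r * (p * r - q\<^sup>2)"
      using f[rule_format, of r "- q"] by (simp add: power2_eq_square algebra_simps)
    then show ?thesis using False r by (simp add: zero_le_mult_iff)
  qed
next
  fix s t assume h: "0 \<le> p" "0 \<le> r" "q\<^sup>2 \<le> p * r"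
  show "0 \<le> p * s\<^sup>2 + 2 * s * t * q + r * t\<^sup>2"
  proof (cases "p = 0")
    case True
    then show ?thesis using h by simp
  next
    case False
    have "p * (p * s\<^sup>2 + 2 * s * t * q + r * t\<^sup>2) = (p * s + q * t)\<^sup>2 + (p * r - q\<^sup>2) * t\<^sup>2"
      by (simp add: power2_eq_square algebra_simps)
    then have "0 \<le> p * (p * s\<^sup>2 + 2 * s * t * q + r * t\<^sup>2)" using h by simp
    then show ?thesis using False h by (simp add: zero_le_mult_iff)
  qed
qed

lemma psd_cone_2_iff:
  "mat_of_rows_list 2 [[p, q], [q, r]] \<in> psd_cone 2 \<longleftrightarrow> 0 \<le> p \<and> 0 \<le> r \<and> q\<^sup>2 \<le> p * r"
proof -
  let ?M = "mat_of_rows_list 2 [[p, q], [q, r]]"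
  \<comment> \<open>A 2 by 2 matrix is a bordered matrix with a 1 by 1 lower block, so the general
    criterion applies.\<close>
  have e: "?M = bordered p (vec 1 (\<lambda>_. q)) (r \<cdot>\<^sub>m 1\<^sub>m 1)"
    by (rule eq_matI)
      (auto simp: bordered_def mat_of_rows_list_def mat_of_col_def mat_of_cols_index less_2_cases_iff)
  have s: "r \<cdot>\<^sub>m 1\<^sub>m 1 \<in> symmetric_mats 1" by (rule symmetric_matsI) auto
  have f: "vec 1 (\<lambda>_. q) \<bullet> u = q * u $ 0" "u \<bullet> ((r \<cdot>\<^sub>m 1\<^sub>m 1) *\<^sub>v u) = r * (u $ 0)\<^sup>2"
    if "u \<in> carrier_vec 1" for u
    using that by (auto simp: scalar_prod_def power2_eq_square)
  have "?M \<in> psd_cone 2 \<longleftrightarrow>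
      (\<forall>t. \<forall>u \<in> carrier_vec 1. 0 \<le> p * t\<^sup>2 + 2 * t * (q * u $ 0) + r * (u $ 0)\<^sup>2)"
    unfolding e using bordered_psd_iff[of "vec 1 (\<lambda>_. q)" 1 "r \<cdot>\<^sub>m 1\<^sub>m 1" p] s f
    by (simp add: numeral_2_eq_2)
  also have "\<dots> \<longleftrightarrow> (\<forall>t s. 0 \<le> p * t\<^sup>2 + 2 * t * s * q + r * s\<^sup>2)"
  proof safe
    fix t s
    assume "\<forall>t. \<forall>u \<in> carrier_vec 1. 0 \<le> p * t\<^sup>2 + 2 * t * (q * u $ 0) + r * (u $ 0)\<^sup>2"
    from this[rule_format, of "vec 1 (\<lambda>_. s)" t]
    show "0 \<le> p * t\<^sup>2 + 2 * t * s * q + r * s\<^sup>2" by (simp add: algebra_simps)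
  next
    fix t and u :: "real vec"
    assume "\<forall>t s. 0 \<le> p * t\<^sup>2 + 2 * t * s * q + r * s\<^sup>2"
    from this[rule_format, of t "u $ 0"]
    show "0 \<le> p * t\<^sup>2 + 2 * t * (q * u $ 0) + r * (u $ 0)\<^sup>2" by (simp add: algebra_simps)
  qed
  finally show ?thesis by (simp add: binary_form_nonneg_iff)
qed

section \<open>Objectives and constraint operators in coordinates\<close>

lemma mat_inner_sum:
  assumes "U \<in> carrier_mat n m" "V \<in> carrier_mat n m"
  shows "mat_inner U V = (\<Sum>i<n. \<Sum>j<m. U $$ (i, j) * V $$ (i, j))"
  using assms unfolding mat_inner_def trace_mat_def diag_mat_def
  by (simp add: interv_sum_list_conv_sum_set_nat lessThan_atLeast0 scalar_prod_def)

text \<open>The border \<open>c\<close> meets \<open>x\<close> once in the first row and once in the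
  first column, whence the factor 2; the corner entry 0 of \<open>Q_bar\<close> removes
  \<open>a\<close>.\<close>

lemma mat_inner_Q_bar:
  assumes Q: "Q \<in> carrier_mat n n" and c: "c \<in> carrier_vec n"
    and x: "x \<in> carrier_vec n" and X: "X \<in> carrier_mat n n"
  shows "mat_inner (Q_bar Q c) (bordered a x X) = mat_inner Q X + 2 * (c \<bullet> x)"
  using assms bordered_carrier[OF c Q] bordered_carrier[OF x X]
  unfolding Q_bar_def
  by (simp add: mat_inner_sum[OF bordered_carrier[OF c Q] bordered_carrier[OF x X]]
      mat_inner_sum[OF Q X] sum.lessThan_Suc_shift sum.distrib bordered_index[OF c Q]
      bordered_index[OF x X] scalar_prod_def lessThan_atLeast0[symmetric] del: sum.lessThan_Suc)

text \<open>Entries of a congruence are values of the bilinear form of \<open>Y\<close> at rows of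
  \<open>F\<close>. Both operators thereby reduce to \<open>bordered_form\<close>.\<close>

lemma congruence_index:
  assumes "F \<in> carrier_mat r n" "Y \<in> carrier_mat n n" "i < r" "j < r"
  shows "(F * Y * transpose_mat F) $$ (i, j) = row F i \<bullet> (Y *\<^sub>v row F j)"
proof -
  have "F * Y * transpose_mat F = F * (Y * transpose_mat F)"
    using assms by (intro assoc_mult_mat) auto
  moreover have "col (Y * transpose_mat F) j = Y *\<^sub>v row F j"
    using assms by (intro eq_vecI) auto
  ultimately show ?thesis using assms by simp
qed

lemma A_op_carrier:
  assumes "A \<in> carrier_mat m n" "b \<in> carrier_vec m"
  shows "A_op A b Y \<in> carrier_mat m m"
  using assms unfolding A_op_def append_cols_def by (auto simp: mat_of_col_def Let_def)

lemma A_op_index: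
  assumes A: "A \<in> carrier_mat m n" and b: "b \<in> carrier_vec m"
    and Y: "Y \<in> carrier_mat (Suc n) (Suc n)" and ij: "i < m" "j < m"
  shows "A_op A b Y $$ (i, j)
       = vCons (- b $ i) (row A i) \<bullet> (Y *\<^sub>v vCons (- b $ j) (row A j))"
proof -
  let ?F = "append_cols (mat_of_col (- b)) A"
  have F: "?F \<in> carrier_mat m (Suc n)"
    using A b unfolding append_cols_def by (auto simp: mat_of_col_def)
  have r: "row ?F i = vCons (- b $ i) (row A i)" if "i < m" for i
    using A b that unfolding append_cols_def
    by (intro eq_vecI) (auto simp: mat_of_col_def mat_of_cols_index vec_index_vCons)
  show ?thesis
    unfolding A_op_def Let_def by (simp add: congruence_index[OF F Y ij] r ij)
qed

lemma B_op_carrier: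
  assumes "B \<in> carrier_mat l n" "d \<in> carrier_vec l"
  shows "B_op n B d Y \<in> carrier_mat (Suc l) (Suc l)"
  using assms unfolding B_op_def by (auto simp: mat_of_col_def Let_def)

text \<open>These are the rows of the block matrix inside \<open>B_op\<close>. Row 0 is the first
  unit vector, so row 0 of the product pairs the constant 1 with each inequality; constraint
  \<open>i\<close> sits at index \<open>Suc i\<close>.\<close>

definition B_row :: "nat \<Rightarrow> real mat \<Rightarrow> real vec \<Rightarrow> nat \<Rightarrow> real vec" where
  "B_row n B d i = (case i of 0 \<Rightarrow> vCons 1 (0\<^sub>v n) | Suc i \<Rightarrow> vCons (- d $ i) (row B i))"

lemma B_op_index:
  assumes B: "B \<in> carrier_mat l n" and d: "d \<in> carrier_vec l"
    and Y: "Y \<in> carrier_mat (Suc n) (Suc n)" and ij: "i < Suc l" "j < Suc l"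
  shows "B_op n B d Y $$ (i, j) = B_row n B d i \<bullet> (Y *\<^sub>v B_row n B d j)"
proof -
  let ?G = "four_block_mat (1\<^sub>m 1) (0\<^sub>m 1 n) (mat_of_col (- d)) B"
  have G: "?G \<in> carrier_mat (Suc l) (Suc n)"
    using B d by (auto simp: mat_of_col_def)
  have r: "row ?G i = B_row n B d i" if "i < Suc l" for i
    using B d that
    by (cases i; intro eq_vecI)
      (auto simp: B_row_def mat_of_col_def mat_of_cols_index vec_index_vCons)
  show ?thesis
    unfolding B_op_def Let_def by (simp only: congruence_index[OF G Y ij] r ij)
qed

text \<open>Infima are compared by sending each point of \<open>T\<close> to a point of
  \<open>S\<close> that is at least as good. Neither attainment nor finiteness enters.\<close>

lemma opt_val_mono:
  assumes "\<And>q. q \<in> T \<Longrightarrow> \<exists>p\<in>S. f p \<le> g q"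
  shows "opt_val f S \<le> opt_val g T"
  unfolding opt_val_def by (rule INF_mono) (use assms in force)

lemma Z_set_iff:
  "z \<in> Z_set n k \<longleftrightarrow>
    z \<in> carrier_vec n \<and> (\<forall>i<n. 0 \<le> z $ i \<and> z $ i \<le> 1) \<and> (\<Sum>i<n. z $ i) \<le> real k"
proof (cases "z \<in> carrier_vec n")
  case True
  have "0\<^sub>v n \<le> z \<longleftrightarrow> (\<forall>i<n. 0 \<le> z $ i)" "z \<le> ones_vec n \<longleftrightarrow> (\<forall>i<n. z $ i \<le> 1)"
    using True by (auto simp: less_eq_vec_def ones_vec_def)
  moreover have "ones_vec n \<bullet> z = (\<Sum>i<n. z $ i)"
    using True by (simp add: ones_vec_def scalar_prod_def lessThan_atLeast0)
  ultimately show ?thesis using True by (auto simp: Z_set_def)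
next
  case False
  then show ?thesis by (simp add: Z_set_def)
qed

section \<open>Rank-one lifts, and the linear constraints implied by the lifted ones\<close>

lemma rank_one_form:
  fixes x :: "real vec"
  assumes x: "x \<in> carrier_vec n" and "u \<in> carrier_vec n" "w \<in> carrier_vec n"
  shows "w \<bullet> (mat n n (\<lambda>(i, j). x $ i * x $ j) *\<^sub>v u) = (x \<bullet> w) * (x \<bullet> u)"
proof -
  have "mat n n (\<lambda>(i, j). x $ i * x $ j) *\<^sub>v u = (x \<bullet> u) \<cdot>\<^sub>v x"
    using assms
    by (intro eq_vecI) (auto simp: scalar_prod_def sum_distrib_left mult_ac intro!: sum.cong)
  then show ?thesis using assms comm_scalar_prod[of w n x] by simp
qed

text \<open>The matrix is the outer square of (1, x), so its bilinear form factors.\<close>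

lemma bordered_rank_one_form:
  assumes x: "x \<in> carrier_vec n" and u: "u \<in> carrier_vec n" and w: "w \<in> carrier_vec n"
  shows "vCons s w \<bullet> (bordered 1 x (mat n n (\<lambda>(i, j). x $ i * x $ j)) *\<^sub>v vCons t u)
       = (s + x \<bullet> w) * (t + x \<bullet> u)"
  by (simp add: bordered_form[of x n] rank_one_form assms algebra_simps)

text \<open>A zero diagonal entry says that the vector v = (-b_i, a_i), with a_i the i-th row of
  \<open>A\<close>, is isotropic for the semidefinite matrix. Hence v lies in its kernel, and the
  first coordinate of the image of v is the residual \<open>p\<close> of the i-th equation.\<close>

lemma A_op_bordered_zero_imp:
  assumes A: "A \<in> carrier_mat m n" and b: "b \<in> carrier_vec m"
    and x: "x \<in> carrier_vec n" and X: "X \<in> carrier_mat n n"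
    and psd: "bordered 1 x X \<in> psd_cone (Suc n)"
    and zero: "A_op A b (bordered 1 x X) = 0\<^sub>m m m"
  shows "A *\<^sub>v x = b"
proof (rule eq_vecI)
  fix i assume "i < dim_vec b"
  then have i: "i < m" using b by simp
  define a where "a = row A i"
  have a: "a \<in> carrier_vec n" using A i by (simp add: a_def)
  have Xa: "X *\<^sub>v a \<in> carrier_vec n" using X a by simp
  define p where "p = x \<bullet> a - b $ i"
  have null: "(b $ i)\<^sup>2 - 2 * b $ i * (x \<bullet> a) + a \<bullet> (X *\<^sub>v a) = 0"
    using A_op_index[OF A b bordered_carrier[OF x X] i i, of 1] zero i a
    by (simp add: a_def[symmetric] bordered_form[OF x X] power2_eq_square algebra_simps)
  \<comment> \<open>The form is tested at e_0 + s v with e_0 the first unit vector. The s-square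
    coefficient is the vanishing entry \<open>null\<close>, so the value is affine in
    \<open>s\<close>.\<close>
  have "0 \<le> 1 + 2 * s * p" for s
  proof -
    have "0 \<le> 1 * (1 - s * b $ i)\<^sup>2 + 2 * (1 - s * b $ i) * (x \<bullet> (s \<cdot>\<^sub>v a))
          + (s \<cdot>\<^sub>v a) \<bullet> (X *\<^sub>v (s \<cdot>\<^sub>v a))"
      by (rule psd[unfolded bordered_psd_iff[OF x X], THEN conjunct2, rule_format]) (use a in simp)
    also have "\<dots> = 1 + 2 * s * p
        + s\<^sup>2 * ((b $ i)\<^sup>2 - 2 * b $ i * (x \<bullet> a) + a \<bullet> (X *\<^sub>v a))"
      using x a Xa by (simp add: p_def mult_mat_vec[OF X a] power2_eq_square algebra_simps)
    finally show ?thesis by (simp add: null)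
  qed
  \<comment> \<open>For nonzero \<open>p\<close> this choice of \<open>s\<close> would make the
    value -1.\<close>
  from this[of "- 1 / p"] have "p = 0" by (cases "p = 0") auto
  then show "(A *\<^sub>v x) $ i = b $ i"
    using A i comm_scalar_prod[OF x a] by (simp add: p_def a_def)
qed (use A b in simp)

text \<open>The entry at (0, i + 1) pairs the first unit vector with (-d_i, B_i), where B_i is the
  i-th row of \<open>B\<close>. Since the corner of the bordered matrix is 1, the entry is exactly
  the slack of the i-th inequality.\<close>

lemma B_op_bordered_nonneg_imp:
  assumes B: "B \<in> carrier_mat l n" and d: "d \<in> carrier_vec l"
    and x: "x \<in> carrier_vec n" and X: "X \<in> carrier_mat n n"
    and nonneg: "0\<^sub>m (1 + l) (1 + l) \<le> B_op n B d (bordered 1 x X)"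
  shows "d \<le> B *\<^sub>v x"
  unfolding less_eq_vec_def
proof (intro conjI allI impI)
  fix i assume "i < dim_vec (B *\<^sub>v x)"
  then have i: "i < l" using B by simp
  have r: "row B i \<in> carrier_vec n" and Xr: "X *\<^sub>v row B i \<in> carrier_vec n" using B X i by auto
  have "0 \<le> B_op n B d (bordered 1 x X) $$ (0, Suc i)"
    using nonneg i B_op_carrier[OF B d] unfolding less_eq_mat_def by auto
  also have "\<dots> = B_row n B d 0 \<bullet> (bordered 1 x X *\<^sub>v B_row n B d (Suc i))"
    by (rule B_op_index[OF B d bordered_carrier[OF x X]]) (use i in auto)
  also have "\<dots> = row B i \<bullet> x - d $ i"
    using x r Xr comm_scalar_prod[OF x r]
    by (simp add: B_row_def bordered_form[OF x X r, of "0\<^sub>v n"])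
  finally show "d $ i \<le> (B *\<^sub>v x) $ i" using i B by simp
qed (use B d in auto)

section \<open>The lifted semidefinite constraint\<close>

lemma lifted_psd_iff:
  assumes x: "x \<in> carrier_vec n" and z: "z \<in> carrier_vec n"
    and X: "X \<in> symmetric_mats n" and Z: "Z \<in> symmetric_mats n" and W: "W \<in> carrier_mat n n"
  shows "bordered 1 (x @\<^sub>v z) (four_block_mat X W (transpose_mat W) Z) \<in> psd_cone (1 + n + n) \<longleftrightarrow>
    (\<forall>t. \<forall>u \<in> carrier_vec n. \<forall>g \<in> carrier_vec n.
      0 \<le> t\<^sup>2 + 2 * t * (x \<bullet> u + z \<bullet> g)
          + (u \<bullet> (X *\<^sub>v u) + 2 * (u \<bullet> (W *\<^sub>v g)) + g \<bullet> (Z *\<^sub>v g)))"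
    (is "?M \<in> _ \<longleftrightarrow> _")
proof -
  let ?N = "four_block_mat X W (transpose_mat W) Z"
  note Xc = symmetric_mats_carrier[OF X] and Zc = symmetric_mats_carrier[OF Z]
  have Nc: "?N \<in> carrier_mat (n + n) (n + n)" using Xc Zc W by auto
  have N: "?N \<in> symmetric_mats (n + n)"
    using X Z W Nc transpose_four_block_mat[of X n n W n "transpose_mat W" n Z]
    unfolding symmetric_mats_def by auto
  have "(u @\<^sub>v g) \<bullet> (?N *\<^sub>v (u @\<^sub>v g))
      = u \<bullet> (X *\<^sub>v u) + 2 * (u \<bullet> (W *\<^sub>v g)) + g \<bullet> (Z *\<^sub>v g)"
    if u: "u \<in> carrier_vec n" and g: "g \<in> carrier_vec n" for u g
  proof -
    have Wg: "W *\<^sub>v g \<in> carrier_vec n" and Wu: "transpose_mat W *\<^sub>v u \<in> carrier_vec n"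
      and Xu: "X *\<^sub>v u \<in> carrier_vec n" and Zg: "Z *\<^sub>v g \<in> carrier_vec n"
      using W Xc Zc u g by auto
    \<comment> \<open>The two off-diagonal blocks contribute equally, which accounts for the factor
      2.\<close>
    have "g \<bullet> (transpose_mat W *\<^sub>v u) = u \<bullet> (W *\<^sub>v g)"
      using transpose_vec_mult_scalar[OF W g u] comm_scalar_prod[OF g Wu] by simp
    moreover have "?N *\<^sub>v (u @\<^sub>v g) = (X *\<^sub>v u + W *\<^sub>v g) @\<^sub>v (transpose_mat W *\<^sub>v u + Z *\<^sub>v g)"
      by (rule four_block_mat_mult_vec[of _ n n _ n _ n]) (use W Xc Zc u g in auto)
    ultimately show ?thesis
      using u g Wg Wu Xu Zg
      by (simp add: scalar_prod_append[of _ n _ n] scalar_prod_add_distrib[of _ n])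
  qed
  moreover have "(x @\<^sub>v z) \<bullet> (u @\<^sub>v g) = x \<bullet> u + z \<bullet> g"
    if "u \<in> carrier_vec n" "g \<in> carrier_vec n" for u g
    using that x z by (rule scalar_prod_append[rotated 2])
  moreover have "?M \<in> psd_cone (1 + n + n) \<longleftrightarrow>
      (\<forall>t. \<forall>v \<in> carrier_vec (n + n).
        0 \<le> 1 * t\<^sup>2 + 2 * t * ((x @\<^sub>v z) \<bullet> v) + v \<bullet> (?N *\<^sub>v v))"
    using bordered_psd_iff[of "x @\<^sub>v z" "n + n" ?N 1] x z Nc N by simp
  ultimately show ?thesis by (simp add: all_vec_append)
qed

lemma unit_vec_form:
  assumes "M \<in> carrier_mat n n" "i < n"
  shows "(s \<cdot>\<^sub>v unit_vec n i) \<bullet> (M *\<^sub>v (t \<cdot>\<^sub>v unit_vec n i)) = s * t * (M $$ (i, i) :: real)"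
proof -
  have "unit_vec n i \<bullet> (M *\<^sub>v unit_vec n i) = M $$ (i, i)"
    using assms by (simp add: scalar_prod_left_unit[of _ n] scalar_prod_right_unit[of _ n])
  then show ?thesis
    using assms by (simp add: mult_mat_vec[OF assms(1)])
qed

lemma bordered_psd_diag:
  assumes x: "x \<in> carrier_vec n" and X: "X \<in> carrier_mat n n"
    and psd: "bordered 1 x X \<in> psd_cone (Suc n)" and i: "i < n"
  shows "(x $ i)\<^sup>2 \<le> X $$ (i, i)"
proof -
  \<comment> \<open>At (-x_i, e_i), with e_i the i-th unit vector, the form takes the value X_ii -
    x_i^2.\<close>
  have "0 \<le> 1 * (- x $ i)\<^sup>2 + 2 * (- x $ i) * (x \<bullet> unit_vec n i)
      + unit_vec n i \<bullet> (X *\<^sub>v unit_vec n i)"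
    by (rule psd[unfolded bordered_psd_iff[OF x X], THEN conjunct2, rule_format]) simp
  then show ?thesis
    using unit_vec_form[OF X i, of 1 1] i by (simp add: power2_eq_square)
qed

lemma bordered_psd_diag_nonneg:
  assumes "x \<in> carrier_vec n" "X \<in> carrier_mat n n" "bordered 1 x X \<in> psd_cone (Suc n)" "i < n"
  shows "0 \<le> X $$ (i, i)"
  using bordered_psd_diag[OF assms] zero_le_power2 order_trans by blast

lemma dim_diag_vec: "dim_vec (diag_vec M) = dim_row M"
  by (simp add: diag_vec_def diag_mat_def)

lemma diag_vec_index: "i < dim_row M \<Longrightarrow> diag_vec M $ i = M $$ (i, i)"
  unfolding diag_vec_def diag_mat_def vec_of_list_index by simp

text \<open>Only principal submatrices are used. Taking \<open>g = 0\<close> leaves the block of (1,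
  x); taking \<open>t = 0\<close> and multiples of the i-th unit vector leaves the 2 by 2 block of
  x_i and z_i, whose entries are known because \<open>x\<close> and \<open>z\<close> are the
  diagonals of \<open>W\<close> and \<open>Z\<close>.\<close>

lemma lifted_region_imp:
  assumes "(x, z, X, W, Z) \<in> lifted_region n k"
  shows "bordered 1 x X \<in> psd_cone (Suc n)" and "z \<in> Z_set n k"
    and "i < n \<Longrightarrow> 0 \<le> z $ i \<and> 0 \<le> X $$ (i, i) \<and> (x $ i)\<^sup>2 \<le> z $ i * X $$ (i, i)"
proof -
  from assms have x: "x \<in> carrier_vec n" and z: "z \<in> carrier_vec n"
    and X: "X \<in> symmetric_mats n" and Z: "Z \<in> symmetric_mats n" and W: "W \<in> carrier_mat n n"
    and xW: "x = diag_vec W" and zZ: "z = diag_vec Z" and zset: "z \<in> Z_set n k"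
    and psd: "bordered 1 (x @\<^sub>v z) (four_block_mat X W (transpose_mat W) Z) \<in> psd_cone (1 + n + n)"
    unfolding lifted_region_def by auto
  note Xc = symmetric_mats_carrier[OF X] and Zc = symmetric_mats_carrier[OF Z]
  note form = psd[unfolded lifted_psd_iff[OF x z X Z W], rule_format]
  show "z \<in> Z_set n k" by (fact zset)
  show "bordered 1 x X \<in> psd_cone (Suc n)"
    unfolding bordered_psd_iff[OF x Xc]
  proof (intro conjI allI ballI X)
    fix t and u :: "real vec" assume u: "u \<in> carrier_vec n"
    have "W *\<^sub>v 0\<^sub>v n = 0\<^sub>v n" using W by (intro eq_vecI) auto
    moreover have "Z *\<^sub>v 0\<^sub>v n = 0\<^sub>v n" using Zc by (intro eq_vecI) auto
    ultimately show "0 \<le> 1 * t\<^sup>2 + 2 * t * (x \<bullet> u) + u \<bullet> (X *\<^sub>v u)"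
      using form[OF u zero_carrier_vec, of t] u z by simp
  qed
  assume i: "i < n"
  have Wii: "W $$ (i, i) = x $ i" and Zii: "Z $$ (i, i) = z $ i"
    using W Zc i unfolding xW zZ by (simp_all add: diag_vec_index)
  have "0 \<le> z $ i * s\<^sup>2 + 2 * s * t * x $ i + X $$ (i, i) * t\<^sup>2" for s t
    using form[of "t \<cdot>\<^sub>v unit_vec n i" "s \<cdot>\<^sub>v unit_vec n i" 0]
    by (simp add: unit_vec_form[OF _ i] Xc Zc W Wii Zii power2_eq_square algebra_simps)
  then show "0 \<le> z $ i \<and> 0 \<le> X $$ (i, i) \<and> (x $ i)\<^sup>2 \<le> z $ i * X $$ (i, i)"
    by (simp add: binary_form_nonneg_iff[symmetric])
qed

text \<open>
  If \<open>u\<^sub>0, u\<close> are vectors with Gram matrix \<open>[1 x; x y]\<close>, then \<open>\<alpha>\<close> and \<open>\<beta>\<close> make the vector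
  \<open>w = \<alpha> u\<^sub>0 + \<beta> u\<close> satisfy \<open>\<langle>u\<^sub>0, w\<rangle> = z\<close>, \<open>\<langle>u, w\<rangle> = x\<close> and \<open>\<parallel>w\<parallel>\<^sup>2 \<le> z\<close>. If \<open>y = x\<^sup>2\<close>, division by
  zero gives \<open>\<beta> = 0\<close>, which is the right value since then \<open>x = 0\<close> or \<open>z = 1\<close>.
\<close>

lemma completion_coefficients:
  fixes x z y :: real
  defines "\<beta> \<equiv> x * (1 - z) / (y - x\<^sup>2)"
  defines "\<alpha> \<equiv> z - \<beta> * x"
  assumes z: "0 \<le> z" "z \<le> 1" and xy: "x\<^sup>2 \<le> y" and xzy: "x\<^sup>2 \<le> z * y"
  shows "\<alpha> * x + \<beta> * y = x" and "\<alpha> * z + \<beta> * x \<le> z"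
proof -
  have deg: "x * (1 - z) = 0" if "y = x\<^sup>2"
  proof -
    have "x\<^sup>2 * (1 - z) \<le> 0" using xzy that by (simp add: algebra_simps)
    then show ?thesis using z by (auto simp: mult_le_0_iff)
  qed
  have "\<beta> * (y - x\<^sup>2) = x * (1 - z)" using deg by (auto simp: \<beta>_def)
  then show "\<alpha> * x + \<beta> * y = x" by (simp add: \<alpha>_def power2_eq_square algebra_simps)
  have "\<beta> * x \<le> z"
  proof (cases "y = x\<^sup>2")
    case True
    then show ?thesis using z by (simp add: \<beta>_def)
  next
    case False
    have "x\<^sup>2 * (1 - z) \<le> z * (y - x\<^sup>2)" using xzy by (simp add: algebra_simps)
    then show ?thesis using False xy by (simp add: \<beta>_def power2_eq_square field_simps)
  qed
  \<comment> \<open>The slack \<open>z - (\<alpha> * z + \<beta> * x)\<close> factors as this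
    product.\<close>
  then have "0 \<le> (1 - z) * (z - \<beta> * x)" using z by simp
  then show "\<alpha> * z + \<beta> * x \<le> z" by (simp add: \<alpha>_def algebra_simps)
qed

text \<open>In Gram vectors, w_i is \<open>\<alpha> i\<close> times u_0 plus
  \<open>\<beta> i\<close> times u_i plus a new orthogonal vector of squared length
  \<open>\<gamma> i\<close>. The new vectors are also mutually orthogonal.\<close>

lemma lifted_region_completion:
  assumes x: "x \<in> carrier_vec n" and X: "X \<in> symmetric_mats n"
    and psd: "bordered 1 x X \<in> psd_cone (Suc n)" and zset: "z \<in> Z_set n k"
    and zX: "\<And>i. i < n \<Longrightarrow> (x $ i)\<^sup>2 \<le> z $ i * X $$ (i, i)"
  shows "\<exists>W Z. (x, z, X, W, Z) \<in> lifted_region n k"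
proof -
  note Xc = symmetric_mats_carrier[OF X]
  note form = psd[unfolded bordered_psd_iff[OF x Xc], THEN conjunct2, rule_format]
  have z: "z \<in> carrier_vec n" and z01: "\<And>i. i < n \<Longrightarrow> 0 \<le> z $ i" "\<And>i. i < n \<Longrightarrow> z $ i \<le> 1"
    using zset by (simp_all add: Z_set_iff)
  define \<beta> where "\<beta> i = x $ i * (1 - z $ i) / (X $$ (i, i) - (x $ i)\<^sup>2)" for i
  define \<alpha> where "\<alpha> i = z $ i - \<beta> i * x $ i" for i
  \<comment> \<open>The part of w_i in the span of u_0 and u_i has squared length
    \<open>\<alpha> i * z $ i + \<beta> i * x $ i\<close>; \<open>\<gamma> i\<close> fills the gap
    up to z_i.\<close>
  define \<gamma> where "\<gamma> i = z $ i - (\<alpha> i * z $ i + \<beta> i * x $ i)" for i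
  have \<alpha>\<beta>: "\<alpha> i * x $ i + \<beta> i * X $$ (i, i) = x $ i" and \<gamma>: "0 \<le> \<gamma> i" if "i < n" for i
    using completion_coefficients[OF z01[OF that] bordered_psd_diag[OF x Xc psd that] zX[OF that]]
    by (simp_all add: \<alpha>_def \<beta>_def \<gamma>_def)
  \<comment> \<open>Entry (i, j) of \<open>W\<close> is the inner product of u_i and w_j, that of
    \<open>Z\<close> the inner product of w_i and w_j. The new directions affect only the diagonal
    of \<open>Z\<close>.\<close>
  define W where "W = mat n n (\<lambda>(i, j). \<alpha> j * x $ i + \<beta> j * X $$ (i, j))"
  define Z where "Z = mat n n (\<lambda>(i, j). \<alpha> i * \<alpha> j + \<alpha> i * \<beta> j * x $ j + \<alpha> j * \<beta> i * x $ i
    + \<beta> i * \<beta> j * X $$ (i, j) + (if i = j then \<gamma> i else 0))"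
  have Wc: "W \<in> carrier_mat n n" by (simp add: W_def)
  have Zs: "Z \<in> symmetric_mats n"
    by (rule symmetric_matsI) (auto simp: Z_def symmetric_mats_index[OF X])
  have xW: "x = diag_vec W"
    using x \<alpha>\<beta> by (intro eq_vecI) (auto simp: dim_diag_vec diag_vec_index W_def)
  have "Z $$ (i, i) = z $ i" if "i < n" for i
  proof -
    \<comment> \<open>Grouping exposes the inner products of w_i with u_0 and u_i, namely z_i and
      x_i.\<close>
    have "Z $$ (i, i) = \<alpha> i * (\<alpha> i + \<beta> i * x $ i)
        + \<beta> i * (\<alpha> i * x $ i + \<beta> i * X $$ (i, i)) + \<gamma> i"
      using that by (simp add: Z_def algebra_simps)
    also have "\<dots> = z $ i" using that by (simp add: \<alpha>\<beta> \<gamma>_def) (simp add: \<alpha>_def)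
    finally show ?thesis .
  qed
  then have zZ: "z = diag_vec Z"
    using z symmetric_mats_carrier[OF Zs]
    by (intro eq_vecI) (auto simp: dim_diag_vec diag_vec_index)
  have "0 \<le> t\<^sup>2 + 2 * t * (x \<bullet> u + z \<bullet> g)
          + (u \<bullet> (X *\<^sub>v u) + 2 * (u \<bullet> (W *\<^sub>v g)) + g \<bullet> (Z *\<^sub>v g))"
    if u: "u \<in> carrier_vec n" and g: "g \<in> carrier_vec n" for t u g
  proof -
    \<comment> \<open>The sum of the g_i w_i has coefficient \<open>s\<close> at u_0 and
      \<open>h $ i\<close> at u_i, besides an orthogonal part of squared length
      \<open>\<Sum>i<n. \<gamma> i * (g $ i)\<^sup>2\<close>. The next identities evaluate its inner
      products.\<close>
    define s where "s = (\<Sum>i<n. \<alpha> i * g $ i)"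
    define h where "h = vec n (\<lambda>i. \<beta> i * g $ i)"
    have h: "h \<in> carrier_vec n" by (simp add: h_def)
    have Xh: "X *\<^sub>v h \<in> carrier_vec n" and Xu: "X *\<^sub>v u \<in> carrier_vec n" using Xc h u by auto
    have xh: "x \<bullet> h = (\<Sum>j<n. \<beta> j * x $ j * g $ j)"
      by (simp add: scalar_prod_def h_def lessThan_atLeast0 algebra_simps)
    have Xhi: "(X *\<^sub>v h) $ i = (\<Sum>j<n. \<beta> j * X $$ (i, j) * g $ j)" if "i < n" for i
      using that Xc by (simp add: scalar_prod_def h_def lessThan_atLeast0 algebra_simps)
    have zg: "z \<bullet> g = s + x \<bullet> h"
      using g unfolding xh s_def sum.distrib[symmetric]
      by (simp add: scalar_prod_def lessThan_atLeast0 \<alpha>_def algebra_simps)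
    have "W *\<^sub>v g = s \<cdot>\<^sub>v x + X *\<^sub>v h"
    proof (rule eq_vecI)
      fix i assume "i < dim_vec (s \<cdot>\<^sub>v x + X *\<^sub>v h)"
      then have i: "i < n" using Xc by simp
      have "(W *\<^sub>v g) $ i = (\<Sum>j<n. (\<alpha> j * x $ i + \<beta> j * X $$ (i, j)) * g $ j)"
        using i g by (simp add: W_def scalar_prod_def lessThan_atLeast0)
      also have "\<dots> = s * x $ i + (X *\<^sub>v h) $ i"
        unfolding Xhi[OF i] s_def sum_distrib_right sum.distrib[symmetric]
        by (simp add: algebra_simps)
      finally show "(W *\<^sub>v g) $ i = (s \<cdot>\<^sub>v x + X *\<^sub>v h) $ i" using i x Xc by simp
    qed (use Xc in \<open>simp add: W_def\<close>)
    then have uWg: "u \<bullet> (W *\<^sub>v g) = s * (x \<bullet> u) + u \<bullet> (X *\<^sub>v h)"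
      using u x Xh comm_scalar_prod[OF u x] by (simp add: scalar_prod_add_distrib[of _ n])
    have Zg: "(Z *\<^sub>v g) $ i = \<alpha> i * (s + x \<bullet> h) + \<beta> i * (s * x $ i + (X *\<^sub>v h) $ i) + \<gamma> i * g $ i"
      if i: "i < n" for i
    proof -
      have "(Z *\<^sub>v g) $ i = (\<Sum>j<n. Z $$ (i, j) * g $ j)"
        using i g by (simp add: Z_def scalar_prod_def lessThan_atLeast0)
      also have "\<dots> = (\<Sum>j<n. \<alpha> i * (\<alpha> j * g $ j + \<beta> j * x $ j * g $ j)
          + \<beta> i * (\<alpha> j * g $ j * x $ i + \<beta> j * X $$ (i, j) * g $ j)
          + (if j = i then \<gamma> i * g $ i else 0))"
        using i by (intro sum.cong) (auto simp: Z_def algebra_simps)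
      also have "\<dots> = \<alpha> i * (s + x \<bullet> h) + \<beta> i * (s * x $ i + (X *\<^sub>v h) $ i) + \<gamma> i * g $ i"
        unfolding xh Xhi[OF i] s_def sum.distrib sum_distrib_left[symmetric] sum_distrib_right[symmetric]
        using i by simp
      finally show ?thesis .
    qed
    have "g \<bullet> (Z *\<^sub>v g) = (\<Sum>i<n. g $ i * (Z *\<^sub>v g) $ i)"
      by (simp add: Z_def scalar_prod_def lessThan_atLeast0)
    also have "\<dots> = (\<Sum>i<n. (s + x \<bullet> h) * (\<alpha> i * g $ i) + s * (\<beta> i * x $ i * g $ i)
        + \<beta> i * g $ i * (X *\<^sub>v h) $ i + \<gamma> i * (g $ i)\<^sup>2)"
      by (intro sum.cong) (auto simp: Zg power2_eq_square algebra_simps)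
    also have "\<dots> = (s + x \<bullet> h) * s + s * (x \<bullet> h) + h \<bullet> (X *\<^sub>v h) + (\<Sum>i<n. \<gamma> i * (g $ i)\<^sup>2)"
    proof -
      have "h \<bullet> y = (\<Sum>i<n. \<beta> i * g $ i * y $ i)" if "y \<in> carrier_vec n" for y
        using that by (simp add: scalar_prod_def h_def lessThan_atLeast0)
      from this[OF Xh] show ?thesis
        by (simp only: sum.distrib sum_distrib_left[symmetric] s_def[symmetric] xh[symmetric])
    qed
    finally have gZg: "g \<bullet> (Z *\<^sub>v g) = s\<^sup>2 + 2 * s * (x \<bullet> h) + h \<bullet> (X *\<^sub>v h)
        + (\<Sum>i<n. \<gamma> i * (g $ i)\<^sup>2)"
      by (simp add: power2_eq_square algebra_simps)
    have sym: "h \<bullet> (X *\<^sub>v u) = u \<bullet> (X *\<^sub>v h)"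
      using transpose_vec_mult_scalar[OF Xc u h] X comm_scalar_prod[OF h Xu] comm_scalar_prod[OF u Xh]
      by (simp add: symmetric_mats_def)
    \<comment> \<open>The lifted form at (t, u, g) is the form of the bordered matrix at (t + s, u +
      h) plus the squared length of the orthogonal part.\<close>
    have "0 \<le> 1 * (t + s)\<^sup>2 + 2 * (t + s) * (x \<bullet> (u + h)) + (u + h) \<bullet> (X *\<^sub>v (u + h))"
      by (rule form) (use u h in simp)
    moreover have "0 \<le> (\<Sum>i<n. \<gamma> i * (g $ i)\<^sup>2)" by (rule sum_nonneg) (simp add: \<gamma>)
    moreover have "x \<bullet> (u + h) = x \<bullet> u + x \<bullet> h" by (rule scalar_prod_add_distrib[OF x u h])
    moreover have "(u + h) \<bullet> (X *\<^sub>v (u + h)) = u \<bullet> (X *\<^sub>v u) + 2 * (u \<bullet> (X *\<^sub>v h)) + h \<bullet> (X *\<^sub>v h)"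
      using u h Xu Xh sym
      by (simp add: mult_add_distrib_mat_vec[OF Xc] scalar_prod_add_distrib[of _ n]
          add_scalar_prod_distrib[of _ n])
    ultimately show ?thesis
      unfolding uWg gZg zg by (simp add: power2_eq_square algebra_simps)
  qed
  then have "(x, z, X, W, Z) \<in> lifted_region n k"
    unfolding lifted_region_def using x z X Zs Wc xW zZ zset lifted_psd_iff[OF x z X Zs Wc] by simp
  then show ?thesis by blast
qed

section \<open>Transfer of feasible points between the problems\<close>

lemma RED_feasible_iff:
  "(Y, z) \<in> RED_feasible n m l k A b B d \<longleftrightarrow>
    (\<exists>x X. Y = bordered 1 x X \<and> x \<in> carrier_vec n \<and> X \<in> symmetric_mats n \<and>
      A_op A b Y = 0\<^sub>m m m \<and> 0\<^sub>m (1 + l) (1 + l) \<le> B_op n B d Y \<and>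
      Y \<in> psd_cone (Suc n) \<and> z \<in> Z_set n k \<and> (\<forall>i<n. (x $ i)\<^sup>2 \<le> z $ i * X $$ (i, i)))"
    (is "?l \<longleftrightarrow> ?r")
proof
  assume ?l
  then show ?r
    unfolding RED_feasible_def
    by (simp add: psd_cone_2_iff) (metis bordered_symmetric_iff)
next
  assume ?r
  then obtain x X where Y: "Y = bordered 1 x X"
    and x: "x \<in> carrier_vec n" and X: "X \<in> symmetric_mats n"
    and r: "A_op A b Y = 0\<^sub>m m m" "0\<^sub>m (1 + l) (1 + l) \<le> B_op n B d Y" "Y \<in> psd_cone (Suc n)"
      "z \<in> Z_set n k" "\<forall>i<n. (x $ i)\<^sup>2 \<le> z $ i * X $$ (i, i)"
    by blast
  note Xc = symmetric_mats_carrier[OF X]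
  \<comment> \<open>The right-hand side records only the determinants of the 2 by 2 blocks. Their
    diagonal signs come from \<open>Z_set\<close> and from the semidefiniteness of
    \<open>Y\<close>.\<close>
  have "0 \<le> X $$ (i, i)" if "i < n" for i
    using bordered_psd_diag_nonneg[OF x Xc _ that] r(3) Y by simp
  then have "\<forall>i<n. mat_of_rows_list 2 [[z $ i, x $ i], [x $ i, X $$ (i, i)]] \<in> psd_cone 2"
    using r(4,5) by (simp add: psd_cone_2_iff Z_set_iff)
  moreover have "Y \<in> symmetric_mats (n + 1)"
    using bordered_symmetric_iff[OF x Xc] X Y by simp
  moreover have "z \<in> carrier_vec n" using r(4) by (simp add: Z_set_iff)
  ultimately show ?l
    unfolding RED_feasible_def using Y x Xc r by auto
qed

lemma SDP_RLT_subset_SDP: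
  assumes A: "A \<in> carrier_mat m n" and b: "b \<in> carrier_vec m"
    and B: "B \<in> carrier_mat l n" and d: "d \<in> carrier_vec l"
  shows "SDP_RLT_feasible n m l k A b B d \<subseteq> SDP_feasible n k A b B d"
proof
  fix p assume p: "p \<in> SDP_RLT_feasible n m l k A b B d"
  obtain x z X W Z where p_eq: "p = (x, z, X, W, Z)" by (cases p)
  from p have r: "(x, z, X, W, Z) \<in> lifted_region n k"
    and AY: "A_op A b (bordered 1 x X) = 0\<^sub>m m m"
    and BY: "0\<^sub>m (1 + l) (1 + l) \<le> B_op n B d (bordered 1 x X)"
    unfolding SDP_RLT_feasible_def p_eq by auto
  from r have x: "x \<in> carrier_vec n" and X: "X \<in> carrier_mat n n"
    unfolding lifted_region_def by (auto intro: symmetric_mats_carrier)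
  show "p \<in> SDP_feasible n k A b B d"
    using r A_op_bordered_zero_imp[OF A b x X lifted_region_imp(1)[OF r] AY]
      B_op_bordered_nonneg_imp[OF B d x X BY]
    unfolding SDP_feasible_def p_eq by auto
qed

lemma SDP_RLT_imp_RED:
  assumes "(x, z, X, W, Z) \<in> SDP_RLT_feasible n m l k A b B d"
  shows "(bordered 1 x X, z) \<in> RED_feasible n m l k A b B d"
proof -
  from assms have r: "(x, z, X, W, Z) \<in> lifted_region n k"
    and AY: "A_op A b (bordered 1 x X) = 0\<^sub>m m m"
    and BY: "0\<^sub>m (1 + l) (1 + l) \<le> B_op n B d (bordered 1 x X)"
    unfolding SDP_RLT_feasible_def by auto
  from r have "x \<in> carrier_vec n" "X \<in> symmetric_mats n"
    unfolding lifted_region_def by auto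
  then show ?thesis
    unfolding RED_feasible_iff using lifted_region_imp[OF r] AY BY by blast
qed

lemma RED_imp_SDP_RLT:
  assumes "(Y, z) \<in> RED_feasible n m l k A b B d"
  obtains x X W Z where "Y = bordered 1 x X" "(x, z, X, W, Z) \<in> SDP_RLT_feasible n m l k A b B d"
proof -
  from assms obtain x X where "Y = bordered 1 x X" "x \<in> carrier_vec n" "X \<in> symmetric_mats n"
    "A_op A b Y = 0\<^sub>m m m" "0\<^sub>m (1 + l) (1 + l) \<le> B_op n B d Y" "Y \<in> psd_cone (Suc n)"
    "z \<in> Z_set n k" "\<forall>i<n. (x $ i)\<^sup>2 \<le> z $ i * X $$ (i, i)"
    unfolding RED_feasible_iff by blast
  moreover from this obtain W Z where "(x, z, X, W, Z) \<in> lifted_region n k"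
    using lifted_region_completion by blast
  ultimately show thesis by (intro that[of x X W Z]) (auto simp: SDP_RLT_feasible_def)
qed

text \<open>The i-th 2 by 2 form is evaluated at (t, u_i), here with u_i the coordinates of
  \<open>u\<close>. The sum over i is the cone form with corner entry the sum of the z_i, which is
  at most \<open>k\<close>.\<close>

lemma RED_imp_SC:
  assumes "(Y, z) \<in> RED_feasible n m l k A b B d"
  shows "Y \<in> SC_feasible n m l k A b B d"
proof -
  from assms obtain x X where Y: "Y = bordered 1 x X"
    and x: "x \<in> carrier_vec n" and X: "X \<in> symmetric_mats n"
    and AB: "A_op A b Y = 0\<^sub>m m m" "0\<^sub>m (1 + l) (1 + l) \<le> B_op n B d Y"
    and psd: "Y \<in> psd_cone (Suc n)"
    and z: "z \<in> Z_set n k" and zX: "\<forall>i<n. (x $ i)\<^sup>2 \<le> z $ i * X $$ (i, i)"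
    unfolding RED_feasible_iff by blast
  note Xc = symmetric_mats_carrier[OF X]
  have "bordered (real k * 1) x (diag_part X) \<in> psd_cone (Suc n)"
    unfolding bordered_psd_iff[OF x diag_part_carrier[OF Xc]]
  proof (intro conjI allI ballI diag_part_symmetric[OF Xc])
    fix t and u :: "real vec" assume u: "u \<in> carrier_vec n"
    have "0 \<le> (\<Sum>i<n. z $ i * t\<^sup>2 + 2 * t * u $ i * x $ i + X $$ (i, i) * (u $ i)\<^sup>2)"
    proof (rule sum_nonneg)
      fix i assume "i \<in> {..<n}"
      then have i: "i < n" by simp
      have "0 \<le> z $ i" "0 \<le> X $$ (i, i)" "(x $ i)\<^sup>2 \<le> z $ i * X $$ (i, i)"
        using z zX i bordered_psd_diag_nonneg[OF x Xc psd[unfolded Y] i]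
        by (auto simp: Z_set_iff)
      then show "0 \<le> z $ i * t\<^sup>2 + 2 * t * u $ i * x $ i + X $$ (i, i) * (u $ i)\<^sup>2"
        using binary_form_nonneg_iff[of "z $ i" "x $ i" "X $$ (i, i)"] by blast
    qed
    also have "\<dots> = (\<Sum>i<n. z $ i) * t\<^sup>2 + 2 * t * (x \<bullet> u) + u \<bullet> (diag_part X *\<^sub>v u)"
    proof -
      have "x \<bullet> u = (\<Sum>i<n. u $ i * x $ i)"
        using u by (simp add: scalar_prod_def lessThan_atLeast0 mult.commute)
      then show ?thesis
        by (simp add: sum.distrib diag_part_form[OF Xc u] sum_distrib_left sum_distrib_right
            mult.assoc)
    qed
    also have "\<dots> \<le> real k * 1 * t\<^sup>2 + 2 * t * (x \<bullet> u) + u \<bullet> (diag_part X *\<^sub>v u)"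
      using z by (simp add: Z_set_iff mult_right_mono)
    finally show "0 \<le> real k * 1 * t\<^sup>2 + 2 * t * (x \<bullet> u) + u \<bullet> (diag_part X *\<^sub>v u)" .
  qed
  then have "Y \<in> K_cone n k"
    unfolding Y bordered_K_cone_iff[OF x X] .
  moreover have "Y \<in> symmetric_mats (n + 1)"
    using bordered_symmetric_iff[OF x Xc] X Y by simp
  moreover have "Y $$ (0, 0) = 1" by (simp add: Y bordered_index[OF x Xc])
  ultimately show ?thesis
    unfolding SC_feasible_def using AB psd by simp
qed

text \<open>Each z_i is the least value its 2 by 2 constraint permits when X_ii > 0. Minimizing the
  cone form over \<open>u\<close> at \<open>t = 1\<close> bounds the sum of the z_i.\<close>

lemma SC_imp_RED:
  assumes "Y \<in> SC_feasible n m l k A b B d"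
  shows "\<exists>z. (Y, z) \<in> RED_feasible n m l k A b B d"
proof -
  from assms have Ys: "Y \<in> symmetric_mats (Suc n)" and Y00: "Y $$ (0, 0) = 1"
    and AB: "A_op A b Y = 0\<^sub>m m m" "0\<^sub>m (1 + l) (1 + l) \<le> B_op n B d Y"
    and YK: "Y \<in> K_cone n k" and psd: "Y \<in> psd_cone (Suc n)"
    unfolding SC_feasible_def by auto
  from symmetric_mats_bordered[OF Ys] obtain x X where Y: "Y = bordered 1 x X"
    and x: "x \<in> carrier_vec n" and X: "X \<in> symmetric_mats n"
    unfolding Y00 by blast
  note Xc = symmetric_mats_carrier[OF X]
  note xX = bordered_psd_diag[OF x Xc psd[unfolded Y]]
  note X0 = bordered_psd_diag_nonneg[OF x Xc psd[unfolded Y]]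
  define z where "z = vec n (\<lambda>i. (x $ i)\<^sup>2 / X $$ (i, i))"
  \<comment> \<open>This is the minimizer when all X_ii are positive. The linear term becomes -2
    times the sum of the z_i and the quadratic term adds that sum once, leaving \<open>k\<close>
    minus the sum.\<close>
  define u where "u = vec n (\<lambda>i. - x $ i / X $$ (i, i))"
  have u: "u \<in> carrier_vec n" by (simp add: u_def)
  have "bordered (real k * 1) x (diag_part X) \<in> psd_cone (Suc n)"
    using YK unfolding Y bordered_K_cone_iff[OF x X] .
  then have "0 \<le> real k * 1 * 1\<^sup>2 + 2 * 1 * (x \<bullet> u) + u \<bullet> (diag_part X *\<^sub>v u)"
    using u unfolding bordered_psd_iff[OF x diag_part_carrier[OF Xc]] by blast
  also have "x \<bullet> u = - (\<Sum>i<n. z $ i)"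
    by (simp add: u_def z_def scalar_prod_def lessThan_atLeast0 power2_eq_square
        sum_negf[symmetric])
  also have "u \<bullet> (diag_part X *\<^sub>v u) = (\<Sum>i<n. z $ i)"
    unfolding diag_part_form[OF Xc u]
    by (rule sum.cong) (auto simp: u_def z_def power2_eq_square)
  finally have "(\<Sum>i<n. z $ i) \<le> real k" by simp
  moreover have "0 \<le> z $ i \<and> z $ i \<le> 1" if "i < n" for i
    using X0[OF that] xX[OF that] that by (auto simp: z_def divide_le_eq_1)
  ultimately have "z \<in> Z_set n k" by (simp add: Z_set_iff z_def)
  \<comment> \<open>If X_ii = 0, then x_i = 0 because x_i^2 is at most X_ii; the value z_i = 0 from
    division by zero is then correct.\<close>
  moreover have "(x $ i)\<^sup>2 \<le> z $ i * X $$ (i, i)" if "i < n" for i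
    using xX[OF that] that by (cases "X $$ (i, i) = 0") (auto simp: z_def)
  ultimately show ?thesis
    unfolding RED_feasible_iff using Y x X AB psd by blast
qed

text \<open>For the rank-one lift, entries of \<open>A_op\<close> are products of two equation
  residuals, and entries of \<open>B_op\<close> are products of two slacks, with slack 1 for row
  0.\<close>

lemma QP_imp_RED:
  assumes A: "A \<in> carrier_mat m n" and b: "b \<in> carrier_vec m"
    and B: "B \<in> carrier_mat l n" and d: "d \<in> carrier_vec l"
    and qp: "x \<in> QP_feasible n k A b B d"
  shows "\<exists>z. (bordered 1 x (mat n n (\<lambda>(i, j). x $ i * x $ j)), z) \<in> RED_feasible n m l k A b B d"
proof -
  let ?X = "mat n n (\<lambda>(i, j). x $ i * x $ j)"
  from qp have x: "x \<in> carrier_vec n" and Ax: "A *\<^sub>v x = b" and Bx: "d \<le> B *\<^sub>v x"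
    and l0: "l0_norm x \<le> k"
    unfolding QP_feasible_def by auto
  have Xc: "?X \<in> carrier_mat n n" by simp
  have X: "?X \<in> symmetric_mats n" by (rule symmetric_matsI) auto
  have row: "x \<bullet> row M i = (M *\<^sub>v x) $ i" if "M \<in> carrier_mat r n" "i < r" for M r i
    using that comm_scalar_prod[of x n "row M i"] x by simp
  have "A_op A b (bordered 1 x ?X) $$ (i, j) = 0" if ij: "i < m" "j < m" for i j
    unfolding A_op_index[OF A b bordered_carrier[OF x Xc] ij]
    using A ij by (simp add: bordered_rank_one_form[OF x] row[OF A] Ax)
  then have AY: "A_op A b (bordered 1 x ?X) = 0\<^sub>m m m"
    using A_op_carrier[OF A b] by (intro eq_matI) auto
  have B_row: "\<exists>t u. B_row n B d i = vCons t u \<and> u \<in> carrier_vec n \<and> 0 \<le> t + x \<bullet> u"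
    if "i < Suc l" for i
  proof (cases i)
    case 0
    then show ?thesis using x by (auto simp: B_row_def)
  next
    case (Suc i')
    then have "d $ i' \<le> (B *\<^sub>v x) $ i'" using Bx that B by (auto simp: less_eq_vec_def)
    then show ?thesis using Suc that B row[OF B, of i'] by (auto simp: B_row_def)
  qed
  have "0 \<le> B_op n B d (bordered 1 x ?X) $$ (i, j)" if ij: "i < Suc l" "j < Suc l" for i j
    unfolding B_op_index[OF B d bordered_carrier[OF x Xc] ij]
    using B_row[OF ij(1)] B_row[OF ij(2)] by (auto simp: bordered_rank_one_form[OF x])
  then have BY: "0\<^sub>m (1 + l) (1 + l) \<le> B_op n B d (bordered 1 x ?X)"
    using carrier_matD[OF B_op_carrier[OF B d]] by (simp add: less_eq_mat_def)
  have psd: "bordered 1 x ?X \<in> psd_cone (Suc n)"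
    unfolding bordered_psd_iff[OF x Xc]
  proof (intro conjI allI ballI X)
    fix t and u :: "real vec" assume u: "u \<in> carrier_vec n"
    have "1 * t\<^sup>2 + 2 * t * (x \<bullet> u) + u \<bullet> (?X *\<^sub>v u) = (t + x \<bullet> u)\<^sup>2"
      by (simp add: rank_one_form[OF x u u] power2_eq_square algebra_simps)
    then show "0 \<le> 1 * t\<^sup>2 + 2 * t * (x \<bullet> u) + u \<bullet> (?X *\<^sub>v u)" by simp
  qed
  \<comment> \<open>The indicator of the support sums to \<open>l0_norm x\<close>, and multiplying
    by it leaves x_i^2 unchanged.\<close>
  define z :: "real vec" where "z = vec n (\<lambda>i. if x $ i = 0 then 0 else 1)"
  have "(\<Sum>i<n. z $ i) = (\<Sum>i | i < n \<and> x $ i \<noteq> 0. 1)"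
    unfolding z_def by (rule sum.mono_neutral_cong_right) auto
  also have "\<dots> = real (l0_norm x)" using x by (simp add: l0_norm_def)
  finally have "z \<in> Z_set n k" using l0 by (simp add: Z_set_iff z_def)
  moreover have "\<forall>i<n. (x $ i)\<^sup>2 \<le> z $ i * ?X $$ (i, i)"
    by (simp add: z_def power2_eq_square)
  ultimately show ?thesis
    unfolding RED_feasible_iff using x X AY BY psd by blast
qed

section \<open>Comparison of the optimal values\<close>

lemma mat_inner_rank_one:
  assumes Q: "Q \<in> carrier_mat n n" and x: "x \<in> carrier_vec n"
  shows "mat_inner Q (mat n n (\<lambda>(i, j). x $ i * x $ j)) = x \<bullet> (Q *\<^sub>v x)"
proof -
  have "mat_inner Q (mat n n (\<lambda>(i, j). x $ i * x $ j))
      = (\<Sum>i<n. x $ i * (\<Sum>j<n. Q $$ (i, j) * x $ j))"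
    by (simp add: mat_inner_sum[OF Q, of "mat n n _"] sum_distrib_left mult_ac)
  also have "\<dots> = x \<bullet> (Q *\<^sub>v x)"
    using x Q by (simp add: scalar_prod_def lessThan_atLeast0)
  finally show ?thesis .
qed

lemma SDP_obj_eq_RED_obj:
  assumes Q: "Q \<in> carrier_mat n n" and c: "c \<in> carrier_vec n"
    and p: "(x, z, X, W, Z) \<in> SDP_RLT_feasible n m l k A b B d"
  shows "SDP_obj Q c (x, z, X, W, Z) = RED_obj Q c (bordered 1 x X, z)"
proof -
  from p have "x \<in> carrier_vec n" "X \<in> carrier_mat n n"
    unfolding SDP_RLT_feasible_def lifted_region_def by (auto intro: symmetric_mats_carrier)
  then show ?thesis by (simp add: SDP_obj_def RED_obj_def mat_inner_Q_bar[OF Q c])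
qed

lemma SDP_RLT_val_eq_RED_val:
  assumes Q: "Q \<in> carrier_mat n n" and c: "c \<in> carrier_vec n"
  shows "opt_val (SDP_obj Q c) (SDP_RLT_feasible n m l k A b B d)
       = opt_val (RED_obj Q c) (RED_feasible n m l k A b B d)"
proof (rule antisym; rule opt_val_mono)
  fix q assume "q \<in> RED_feasible n m l k A b B d"
  then obtain x X W Z where "q = (bordered 1 x X, snd q)"
    and p: "(x, snd q, X, W, Z) \<in> SDP_RLT_feasible n m l k A b B d"
    by (cases q) (auto elim: RED_imp_SDP_RLT)
  then have "SDP_obj Q c (x, snd q, X, W, Z) = RED_obj Q c q"
    using SDP_obj_eq_RED_obj[OF Q c p] by simp
  then show "\<exists>p\<in>SDP_RLT_feasible n m l k A b B d. SDP_obj Q c p \<le> RED_obj Q c q"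
    using p by (intro bexI[OF _ p]) simp
next
  fix q assume q: "q \<in> SDP_RLT_feasible n m l k A b B d"
  obtain x z X W Z where q_eq: "q = (x, z, X, W, Z)" by (cases q)
  show "\<exists>p\<in>RED_feasible n m l k A b B d. RED_obj Q c p \<le> SDP_obj Q c q"
    using SDP_obj_eq_RED_obj[OF Q c q[unfolded q_eq]]
    unfolding q_eq by (intro bexI[OF _ SDP_RLT_imp_RED[OF q[unfolded q_eq]]]) simp
qed

lemma RED_val_eq_SC_val:
  "opt_val (RED_obj Q c) (RED_feasible n m l k A b B d)
   = opt_val (SC_obj Q c) (SC_feasible n m l k A b B d)"
proof (rule antisym; rule opt_val_mono)
  fix Y assume "Y \<in> SC_feasible n m l k A b B d"
  from SC_imp_RED[OF this] obtain z where z: "(Y, z) \<in> RED_feasible n m l k A b B d" ..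
  show "\<exists>p\<in>RED_feasible n m l k A b B d. RED_obj Q c p \<le> SC_obj Q c Y"
    by (rule bexI[OF _ z]) (simp add: RED_obj_def SC_obj_def)
next
  fix q assume q: "q \<in> RED_feasible n m l k A b B d"
  obtain Y z where q_eq: "q = (Y, z)" by (cases q)
  show "\<exists>Y\<in>SC_feasible n m l k A b B d. SC_obj Q c Y \<le> RED_obj Q c q"
    unfolding q_eq
    by (rule bexI[OF _ RED_imp_SC[OF q[unfolded q_eq]]]) (simp add: RED_obj_def SC_obj_def)
qed

lemma SC_val_le_QP_val:
  assumes Q: "Q \<in> carrier_mat n n" and c: "c \<in> carrier_vec n"
    and A: "A \<in> carrier_mat m n" and b: "b \<in> carrier_vec m"
    and B: "B \<in> carrier_mat l n" and d: "d \<in> carrier_vec l"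
  shows "opt_val (SC_obj Q c) (SC_feasible n m l k A b B d)
       \<le> opt_val (QP_obj Q c) (QP_feasible n k A b B d)"
proof (rule opt_val_mono)
  fix x assume qp: "x \<in> QP_feasible n k A b B d"
  let ?Y = "bordered 1 x (mat n n (\<lambda>(i, j). x $ i * x $ j))"
  have x: "x \<in> carrier_vec n" using qp by (simp add: QP_feasible_def)
  have "SC_obj Q c ?Y = QP_obj Q c x"
    by (simp add: SC_obj_def QP_obj_def mat_inner_Q_bar[OF Q c x] mat_inner_rank_one[OF Q x])
  \<comment> \<open>The support indicator certifies the cone constraint by way of (RED) and is then
    forgotten.\<close>
  moreover have "?Y \<in> SC_feasible n m l k A b B d"
    using QP_imp_RED[OF A b B d qp] RED_imp_SC by blast
  ultimately show "\<exists>Y\<in>SC_feasible n m l k A b B d. SC_obj Q c Y \<le> QP_obj Q c x"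
    by (intro bexI[of _ ?Y]) simp_all
qed

theorem theorem2:
  fixes n m l k :: nat
    and Q A B :: "real mat" and c b d :: "real vec"
  assumes Q: "Q \<in> symmetric_mats n" and c: "c \<in> carrier_vec n"
    and A: "A \<in> carrier_mat m n" and full_row_rank: "vec_space.rank m A = m"
    and b: "b \<in> carrier_vec m"
    and B: "B \<in> carrier_mat l n" and d: "d \<in> carrier_vec l"
    and k: "0 < k" "k < n"
    and feasible: "QP_feasible n k A b B d \<noteq> {}"
    and bounded: "bdd_below (QP_obj Q c ` QP_feasible n k A b B d)"
  shows "opt_val (SDP_obj Q c) (SDP_feasible n k A b B d)
           \<le> opt_val (SDP_obj Q c) (SDP_RLT_feasible n m l k A b B d)
       \<and> opt_val (SDP_obj Q c) (SDP_RLT_feasible n m l k A b B d)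
           = opt_val (RED_obj Q c) (RED_feasible n m l k A b B d)
       \<and> opt_val (RED_obj Q c) (RED_feasible n m l k A b B d)
           = opt_val (SC_obj Q c) (SC_feasible n m l k A b B d)
       \<and> opt_val (SC_obj Q c) (SC_feasible n m l k A b B d)
           \<le> opt_val (QP_obj Q c) (QP_feasible n k A b B d)"
proof (intro conjI)
  note Qc = symmetric_mats_carrier[OF Q]
  show "opt_val (SDP_obj Q c) (SDP_feasible n k A b B d)
      \<le> opt_val (SDP_obj Q c) (SDP_RLT_feasible n m l k A b B d)"
    using SDP_RLT_subset_SDP[OF A b B d] unfolding opt_val_def by (rule INF_superset_mono) simp
  show "opt_val (SDP_obj Q c) (SDP_RLT_feasible n m l k A b B d)
      = opt_val (RED_obj Q c) (RED_feasible n m l k A b B d)"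
    by (rule SDP_RLT_val_eq_RED_val[OF Qc c])
  show "opt_val (RED_obj Q c) (RED_feasible n m l k A b B d)
      = opt_val (SC_obj Q c) (SC_feasible n m l k A b B d)"
    by (rule RED_val_eq_SC_val)
  show "opt_val (SC_obj Q c) (SC_feasible n m l k A b B d)
      \<le> opt_val (QP_obj Q c) (QP_feasible n k A b B d)"
    by (rule SC_val_le_QP_val[OF Qc c A b B d])
qed

end
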